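(* Let $R$ be an associative ring with identity and let $M$ be a unital right $R$-module. Then $M$ is a Rickart module if and only if for any two direct summands $A$ and $B$ of $M$ and every $R$-homomorphism $f\colon A\to B$, the kernel $\operatorname{Ker}(f)$ is a direct summand of $A$.
   Context: A right $R$-module $M$ with endomorphism ring $S=\operatorname{End}_R(M)$ (acting on the left of $M$) is called a Rickart module if for every $\varphi\in S$ there is an idempotent $e=e^2\in S$ with $\operatorname{Ker}(\varphi)=eM$; equivalently, the kernel of every endomorphism of $M$ is a direct summand of $M$. *)

theory Defs
  imports "HOL-Algebra.Module" "HOL-Algebra.AbelCoset"
begin

text \<open>
  The library's locale \<^locale>\<open>module\<close> is restricted to commutative rings, so right modules over
  an arbitrary ring with identity are introduced here. They reuse the library's module record
  (and with it \<^locale>\<open>submodule\<close>), in which the scalar is written on the left: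
  \<open>a \<odot>\<^bsub>M\<^esub> x\<close> stands for the right action \<open>x \<cdot> a\<close>. Hence the associativity law
  \<open>(x \<cdot> a) \<cdot> b = x \<cdot> (a b)\<close> takes the form of \<open>rsmult_assoc\<close> below.
\<close>

locale right_module = R?: ring R + M?: abelian_group M
  for R (structure) and M :: "('a, 'b, 'm) module_scheme" (structure) +
  assumes rsmult_closed [simp, intro]:
      "\<lbrakk>a \<in> carrier R; x \<in> carrier M\<rbrakk> \<Longrightarrow> a \<odot>\<^bsub>M\<^esub> x \<in> carrier M"
    and rsmult_scalar_distr:
      "\<lbrakk>a \<in> carrier R; b \<in> carrier R; x \<in> carrier M\<rbrakk> \<Longrightarrow>
        (a \<oplus>\<^bsub>R\<^esub> b) \<odot>\<^bsub>M\<^esub> x = a \<odot>\<^bsub>M\<^esub> x \<oplus>\<^bsub>M\<^esub> b \<odot>\<^bsub>M\<^esub> x"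
    and rsmult_vector_distr:
      "\<lbrakk>a \<in> carrier R; x \<in> carrier M; y \<in> carrier M\<rbrakk> \<Longrightarrow>
        a \<odot>\<^bsub>M\<^esub> (x \<oplus>\<^bsub>M\<^esub> y) = a \<odot>\<^bsub>M\<^esub> x \<oplus>\<^bsub>M\<^esub> a \<odot>\<^bsub>M\<^esub> y"
    and rsmult_assoc:
      "\<lbrakk>a \<in> carrier R; b \<in> carrier R; x \<in> carrier M\<rbrakk> \<Longrightarrow>
        (a \<otimes>\<^bsub>R\<^esub> b) \<odot>\<^bsub>M\<^esub> x = b \<odot>\<^bsub>M\<^esub> (a \<odot>\<^bsub>M\<^esub> x)"
    and rsmult_one [simp]:
      "x \<in> carrier M \<Longrightarrow> \<one>\<^bsub>R\<^esub> \<odot>\<^bsub>M\<^esub> x = x"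

lemma (in right_module) right_module_submodule:
  assumes "submodule H R M"
  shows "right_module R (M\<lparr>carrier := H\<rparr>)"
proof -
  interpret H: submodule H R M by fact
  have sub: "x \<in> carrier M" if "x \<in> H" for x
    using H.subset that by auto
  have "abelian_group (M\<lparr>carrier := H\<rparr>)"
  proof (rule abelian_groupI)
    fix x assume "x \<in> carrier (M\<lparr>carrier := H\<rparr>)"
    then show "\<exists>y \<in> carrier (M\<lparr>carrier := H\<rparr>). y \<oplus>\<^bsub>M\<lparr>carrier := H\<rparr>\<^esub> x = \<zero>\<^bsub>M\<lparr>carrier := H\<rparr>\<^esub>"
      using H.m_inv_closed[of x] sub M.l_neg[of x] by (auto simp flip: a_inv_def)
  qed (use H.m_closed H.one_closed sub M.a_ac in auto)
  then show ?thesis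
    unfolding right_module_def right_module_axioms_def
    using R.ring_axioms sub
    by (simp add: rsmult_scalar_distr rsmult_vector_distr rsmult_assoc)
qed

text \<open>
  Homomorphisms are taken to be extensional, i.e. \<open>undefined\<close> outside the carrier, so that equality
  of HOL functions is equality of module homomorphisms. Only then is the structure \<open>rmod_End\<close>
  below a ring.
\<close>

definition rmod_hom ::
  "('a, 'k) ring_scheme \<Rightarrow> ('a, 'b, 'm) module_scheme \<Rightarrow> ('a, 'c, 'n) module_scheme \<Rightarrow> ('b \<Rightarrow> 'c) set"
  where "rmod_hom R M N =
    {f \<in> carrier M \<rightarrow>\<^sub>E carrier N.
       (\<forall>x \<in> carrier M. \<forall>y \<in> carrier M. f (x \<oplus>\<^bsub>M\<^esub> y) = f x \<oplus>\<^bsub>N\<^esub> f y) \<and>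
       (\<forall>a \<in> carrier R. \<forall>x \<in> carrier M. f (a \<odot>\<^bsub>M\<^esub> x) = a \<odot>\<^bsub>N\<^esub> f x)}"

definition rmod_End ::
  "('a, 'k) ring_scheme \<Rightarrow> ('a, 'b, 'm) module_scheme \<Rightarrow> ('b \<Rightarrow> 'b) ring"
  where "rmod_End R M =
    \<lparr>carrier = rmod_hom R M M,
     mult = compose (carrier M),
     one = (\<lambda>x \<in> carrier M. x),
     zero = (\<lambda>x \<in> carrier M. \<zero>\<^bsub>M\<^esub>),
     add = (\<lambda>f g. \<lambda>x \<in> carrier M. f x \<oplus>\<^bsub>M\<^esub> g x)\<rparr>"

definition direct_summand ::
  "('a, 'k) ring_scheme \<Rightarrow> ('a, 'b, 'm) module_scheme \<Rightarrow> 'b set \<Rightarrow> bool"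
  where "direct_summand R M A \<longleftrightarrow>
    submodule A R M \<and>
    (\<exists>C. submodule C R M \<and> A <+>\<^bsub>M\<^esub> C = carrier M \<and> A \<inter> C = {\<zero>\<^bsub>M\<^esub>})"

lemma (in right_module) rsmult_zero:
  assumes "a \<in> carrier R" shows "a \<odot>\<^bsub>M\<^esub> \<zero>\<^bsub>M\<^esub> = \<zero>\<^bsub>M\<^esub>"
proof -
  have "a \<odot>\<^bsub>M\<^esub> \<zero>\<^bsub>M\<^esub> \<oplus>\<^bsub>M\<^esub> a \<odot>\<^bsub>M\<^esub> \<zero>\<^bsub>M\<^esub> = a \<odot>\<^bsub>M\<^esub> \<zero>\<^bsub>M\<^esub>"
    using rsmult_vector_distr[OF assms M.zero_closed M.zero_closed] by simp
  then show ?thesis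
    using assms by (metis M.add.l_cancel_one M.zero_closed rsmult_closed)
qed

lemma (in right_module) rsmult_minus:
  assumes "a \<in> carrier R" "x \<in> carrier M"
  shows "a \<odot>\<^bsub>M\<^esub> (\<ominus>\<^bsub>M\<^esub> x) = \<ominus>\<^bsub>M\<^esub> (a \<odot>\<^bsub>M\<^esub> x)"
proof -
  have "a \<odot>\<^bsub>M\<^esub> (\<ominus>\<^bsub>M\<^esub> x) \<oplus>\<^bsub>M\<^esub> a \<odot>\<^bsub>M\<^esub> x = \<zero>\<^bsub>M\<^esub>"
    using rsmult_vector_distr[of a "\<ominus>\<^bsub>M\<^esub> x" x] assms by (simp add: M.l_neg rsmult_zero)
  then show ?thesis
    using assms by (simp add: M.minus_equality)
qed

lemma (in right_module) ring_rmod_End: "ring (rmod_End R M)"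
proof (rule ringI)
  show "abelian_group (rmod_End R M)"
  proof (rule abelian_groupI)
    fix f assume f: "f \<in> carrier (rmod_End R M)"
    then have "(\<lambda>x \<in> carrier M. \<ominus>\<^bsub>M\<^esub> f x) \<in> carrier (rmod_End R M)"
      by (auto simp: rmod_End_def rmod_hom_def PiE_iff M.minus_add rsmult_minus)
    moreover have "(\<lambda>x \<in> carrier M. \<ominus>\<^bsub>M\<^esub> f x) \<oplus>\<^bsub>rmod_End R M\<^esub> f = \<zero>\<^bsub>rmod_End R M\<^esub>"
      using f by (auto simp: rmod_End_def rmod_hom_def PiE_iff M.l_neg)
    ultimately show "\<exists>g \<in> carrier (rmod_End R M). g \<oplus>\<^bsub>rmod_End R M\<^esub> f = \<zero>\<^bsub>rmod_End R M\<^esub>"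
      by blast
  qed (auto simp: rmod_End_def rmod_hom_def PiE_iff rsmult_zero rsmult_vector_distr
      M.a_ac extensional_def fun_eq_iff)
  show "monoid (rmod_End R M)"
    by (rule monoidI)
      (auto simp: rmod_End_def rmod_hom_def PiE_iff compose_def extensional_def fun_eq_iff)
qed (auto simp: rmod_End_def rmod_hom_def PiE_iff compose_def fun_eq_iff)

locale Rickart_module = right_module +
  assumes kernel_eq_idempotent_image:
    "\<phi> \<in> carrier (rmod_End R M) \<Longrightarrow>
      \<exists>e \<in> carrier (rmod_End R M). e \<otimes>\<^bsub>rmod_End R M\<^esub> e = e \<and> a_kernel M M \<phi> = e ` carrier M"

end

theory Submission
  imports Defs
begin

text \<open>
  Direct summands are exactly the images of idempotent endomorphisms. Let \<open>M\<close> be Rickart, let \<open>p\<close>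
  be a projection of \<open>M\<close> onto \<open>A\<close> and let \<open>f : A \<rightarrow> B\<close>. Then \<open>f \<circ> p\<close> is an endomorphism of \<open>M\<close>,
  so its kernel is \<open>e M\<close> for an idempotent \<open>e\<close>. Since \<open>f (p (e a)) = 0\<close> for all \<open>a\<close>, and
  \<open>p (e a) = a\<close> whenever \<open>a \<in> A\<close> and \<open>f a = 0\<close>, the restriction of \<open>p \<circ> e\<close> to \<open>A\<close> is an
  idempotent endomorphism of \<open>A\<close> with image \<open>Ker f\<close>. Conversely, take \<open>A = B = M\<close>.
\<close>

lemma rmod_homI:
  assumes "\<And>x. x \<in> carrier M \<Longrightarrow> f x \<in> carrier N"
    and "\<And>x y. \<lbrakk>x \<in> carrier M; y \<in> carrier M\<rbrakk> \<Longrightarrow> f (x \<oplus>\<^bsub>M\<^esub> y) = f x \<oplus>\<^bsub>N\<^esub> f y"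
    and "\<And>a x. \<lbrakk>a \<in> carrier R; x \<in> carrier M\<rbrakk> \<Longrightarrow> f (a \<odot>\<^bsub>M\<^esub> x) = a \<odot>\<^bsub>N\<^esub> f x"
    and "f \<in> extensional (carrier M)"
  shows "f \<in> rmod_hom R M N"
  using assms by (auto simp: rmod_hom_def PiE_iff)

lemma rmod_homD:
  assumes "f \<in> rmod_hom R M N"
  shows rmod_hom_closed: "x \<in> carrier M \<Longrightarrow> f x \<in> carrier N"
    and rmod_hom_add: "\<lbrakk>x \<in> carrier M; y \<in> carrier M\<rbrakk> \<Longrightarrow> f (x \<oplus>\<^bsub>M\<^esub> y) = f x \<oplus>\<^bsub>N\<^esub> f y"
    and rmod_hom_rsmult: "\<lbrakk>a \<in> carrier R; x \<in> carrier M\<rbrakk> \<Longrightarrow> f (a \<odot>\<^bsub>M\<^esub> x) = a \<odot>\<^bsub>N\<^esub> f x"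
  using assms by (auto simp: rmod_hom_def)

lemma submoduleD:
  assumes "submodule H R M"
  shows submodule_subset: "H \<subseteq> carrier M"
    and submodule_zero: "\<zero>\<^bsub>M\<^esub> \<in> H"
    and submodule_add: "\<And>x y. \<lbrakk>x \<in> H; y \<in> H\<rbrakk> \<Longrightarrow> x \<oplus>\<^bsub>M\<^esub> y \<in> H"
    and submodule_minus: "\<And>x. x \<in> H \<Longrightarrow> \<ominus>\<^bsub>M\<^esub> x \<in> H"
    and submodule_rsmult: "\<And>a x. \<lbrakk>a \<in> carrier R; x \<in> H\<rbrakk> \<Longrightarrow> a \<odot>\<^bsub>M\<^esub> x \<in> H"
proof -
  interpret H: submodule H R M by fact
  show "H \<subseteq> carrier M" "\<zero>\<^bsub>M\<^esub> \<in> H"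
    "\<And>x y. \<lbrakk>x \<in> H; y \<in> H\<rbrakk> \<Longrightarrow> x \<oplus>\<^bsub>M\<^esub> y \<in> H"
    "\<And>x. x \<in> H \<Longrightarrow> \<ominus>\<^bsub>M\<^esub> x \<in> H"
    "\<And>a x. \<lbrakk>a \<in> carrier R; x \<in> H\<rbrakk> \<Longrightarrow> a \<odot>\<^bsub>M\<^esub> x \<in> H"
    using H.subset H.one_closed H.m_closed H.m_inv_closed by (auto simp: a_inv_def)
qed

lemma a_kernel_eq: "a_kernel M N f = {x \<in> carrier M. f x = \<zero>\<^bsub>N\<^esub>}"
  by (simp add: a_kernel_def kernel_def)

context right_module
begin

lemma zero_rsmult:
  assumes "x \<in> carrier M"
  shows "\<zero>\<^bsub>R\<^esub> \<odot>\<^bsub>M\<^esub> x = \<zero>\<^bsub>M\<^esub>"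
proof -
  have "\<zero>\<^bsub>R\<^esub> \<odot>\<^bsub>M\<^esub> x \<oplus>\<^bsub>M\<^esub> \<zero>\<^bsub>R\<^esub> \<odot>\<^bsub>M\<^esub> x = \<zero>\<^bsub>R\<^esub> \<odot>\<^bsub>M\<^esub> x"
    using rsmult_scalar_distr[OF R.zero_closed R.zero_closed assms] by simp
  then show ?thesis
    using assms by (metis M.add.l_cancel_one R.zero_closed rsmult_closed)
qed

lemma minus_one_rsmult:
  assumes "x \<in> carrier M"
  shows "(\<ominus>\<^bsub>R\<^esub> \<one>\<^bsub>R\<^esub>) \<odot>\<^bsub>M\<^esub> x = \<ominus>\<^bsub>M\<^esub> x"
proof -
  have "(\<ominus>\<^bsub>R\<^esub> \<one>\<^bsub>R\<^esub>) \<odot>\<^bsub>M\<^esub> x \<oplus>\<^bsub>M\<^esub> x = \<zero>\<^bsub>M\<^esub>"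
    using rsmult_scalar_distr[of "\<ominus>\<^bsub>R\<^esub> \<one>\<^bsub>R\<^esub>" "\<one>\<^bsub>R\<^esub>" x] assms
    by (simp add: R.l_neg zero_rsmult)
  then show ?thesis
    using assms by (simp add: M.minus_equality)
qed

text \<open>Closure under negation comes from the scalar action: the additive inverse of
  \<open>x\<close> is the result of acting on \<open>x\<close> by minus one.\<close>

lemma submoduleI:
  assumes "H \<subseteq> carrier M" "\<zero>\<^bsub>M\<^esub> \<in> H"
    and "\<And>x y. \<lbrakk>x \<in> H; y \<in> H\<rbrakk> \<Longrightarrow> x \<oplus>\<^bsub>M\<^esub> y \<in> H"
    and rsmult: "\<And>a x. \<lbrakk>a \<in> carrier R; x \<in> H\<rbrakk> \<Longrightarrow> a \<odot>\<^bsub>M\<^esub> x \<in> H"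
  shows "submodule H R M"
proof (intro submodule.intro subgroup.intro submodule_axioms.intro)
  fix x assume "x \<in> H"
  then show "inv\<^bsub>add_monoid M\<^esub> x \<in> H"
    using rsmult[of "\<ominus>\<^bsub>R\<^esub> \<one>\<^bsub>R\<^esub>" x] minus_one_rsmult[of x] assms(1)
    by (auto simp: a_inv_def[of M])
qed (use assms in auto)

text \<open>The zero scalar sends every element to zero in both modules, so compatibility with
  scalars gives f(0) = f(0 0) = 0 f(0) = 0. Negatives are treated in the same way below, with the
  scalar minus one.\<close>

lemma rmod_hom_zero:
  assumes "right_module R N" "f \<in> rmod_hom R M N"
  shows "f \<zero>\<^bsub>M\<^esub> = \<zero>\<^bsub>N\<^esub>"
  using rmod_hom_rsmult[OF assms(2) R.zero_closed M.zero_closed]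
  by (simp add: zero_rsmult right_module.zero_rsmult[OF assms(1)] rmod_hom_closed[OF assms(2)])

lemma rmod_hom_minus:
  assumes "right_module R N" "f \<in> rmod_hom R M N" "x \<in> carrier M"
  shows "f (\<ominus>\<^bsub>M\<^esub> x) = \<ominus>\<^bsub>N\<^esub> f x"
  using rmod_hom_rsmult[OF assms(2) R.a_inv_closed[OF R.one_closed] assms(3)]
  by (simp add: assms minus_one_rsmult right_module.minus_one_rsmult rmod_hom_closed[OF assms(2)])

lemma submodule_a_kernel:
  assumes "right_module R N" "f \<in> rmod_hom R M N"
  shows "submodule (a_kernel M N f) R M"
proof -
  interpret N: right_module R N by fact
  show ?thesis
    by (rule submoduleI)
      (auto simp: a_kernel_eq rmod_homD[OF assms(2)] rmod_hom_zero[OF assms] N.rsmult_zero)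
qed

lemma submodule_image:
  assumes "right_module R N" "f \<in> rmod_hom R M N"
  shows "submodule (f ` carrier M) R N"
proof (rule right_module.submoduleI[OF assms(1)])
  show "\<zero>\<^bsub>N\<^esub> \<in> f ` carrier M"
    by (metis M.zero_closed assms imageI rmod_hom_zero)
  show "x \<oplus>\<^bsub>N\<^esub> y \<in> f ` carrier M" if "x \<in> f ` carrier M" "y \<in> f ` carrier M" for x y
    using that by (auto simp flip: rmod_hom_add[OF assms(2)])
  show "a \<odot>\<^bsub>N\<^esub> x \<in> f ` carrier M" if "a \<in> carrier R" "x \<in> f ` carrier M" for a x
    using that by (auto simp flip: rmod_hom_rsmult[OF assms(2)])
qed (auto simp: rmod_hom_closed[OF assms(2)])

text \<open>The complement is the kernel of \<open>e\<close>: every x splits as e x + (x - e x), and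
  \<open>e\<close> kills the second term because e (e x) = e x.\<close>

lemma direct_summand_idempotent_image:
  assumes e: "e \<in> rmod_hom R M M" and idem: "\<And>x. x \<in> carrier M \<Longrightarrow> e (e x) = e x"
  shows "direct_summand R M (e ` carrier M)"
proof -
  note self = right_module_axioms
  have "x \<in> e ` carrier M <+>\<^bsub>M\<^esub> a_kernel M M e" if x: "x \<in> carrier M" for x
  proof -
    have ex: "e x \<in> carrier M" using rmod_hom_closed[OF e x] .
    have "e (x \<oplus>\<^bsub>M\<^esub> \<ominus>\<^bsub>M\<^esub> e x) = \<zero>\<^bsub>M\<^esub>"
      using x ex by (simp add: rmod_hom_add[OF e] rmod_hom_minus[OF self e] idem M.r_neg)
    then have "x \<oplus>\<^bsub>M\<^esub> \<ominus>\<^bsub>M\<^esub> e x \<in> a_kernel M M e"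
      using x ex by (simp add: a_kernel_eq)
    moreover have "x = e x \<oplus>\<^bsub>M\<^esub> (x \<oplus>\<^bsub>M\<^esub> \<ominus>\<^bsub>M\<^esub> e x)"
      using x ex by (simp add: M.a_lcomm M.r_neg)
    ultimately show ?thesis
      using x unfolding set_add_def' by blast
  qed
  moreover have "e ` carrier M <+>\<^bsub>M\<^esub> a_kernel M M e \<subseteq> carrier M"
    by (auto simp: set_add_def' a_kernel_eq rmod_hom_closed[OF e])
  \<comment> \<open>If x = e y lies in the kernel, then 0 = e (e y) = e y = x.\<close>
  moreover have "e ` carrier M \<inter> a_kernel M M e = {\<zero>\<^bsub>M\<^esub>}"
    using submodule_zero[OF submodule_image[OF self e]] rmod_hom_zero[OF self e]
    by (auto simp: a_kernel_eq idem)
  ultimately show ?thesis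
    unfolding direct_summand_def
    using submodule_image[OF self e] submodule_a_kernel[OF self e] by blast
qed

text \<open>For a complement \<open>C\<close> of \<open>A\<close>, each element has a unique
  decomposition a + c, and \<open>p\<close> picks out a. Since \<open>p\<close> has image
  \<open>A\<close> and fixes \<open>A\<close> pointwise, it is idempotent.\<close>

lemma direct_summand_projection:
  assumes "direct_summand R M A"
  obtains p where "p \<in> rmod_hom R M M" "p ` carrier M = A" "\<And>x. x \<in> A \<Longrightarrow> p x = x"
proof -
  obtain C where A: "submodule A R M" and C: "submodule C R M"
    and sum: "A <+>\<^bsub>M\<^esub> C = carrier M" and disj: "A \<inter> C = {\<zero>\<^bsub>M\<^esub>}"
    using assms unfolding direct_summand_def by blast
  note Asub = submodule_subset[OF A, THEN subsetD] and Csub = submodule_subset[OF C, THEN subsetD]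
  \<comment> \<open>From a + c = a' + c' one gets -a' + a = c' - c. The left side is in
    \<open>A\<close> and the right side in \<open>C\<close>, so both vanish.\<close>
  have unique: "a = a'"
    if "a \<in> A" "a' \<in> A" "c \<in> C" "c' \<in> C" and eq: "a \<oplus>\<^bsub>M\<^esub> c = a' \<oplus>\<^bsub>M\<^esub> c'" for a a' c c'
  proof -
    note cl = that(1,2)[THEN Asub] that(3,4)[THEN Csub]
    have "\<ominus>\<^bsub>M\<^esub> a' \<oplus>\<^bsub>M\<^esub> a = \<ominus>\<^bsub>M\<^esub> a' \<oplus>\<^bsub>M\<^esub> ((a \<oplus>\<^bsub>M\<^esub> c) \<oplus>\<^bsub>M\<^esub> \<ominus>\<^bsub>M\<^esub> c)"
      using cl by (simp add: M.a_assoc M.r_neg)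
    also have "\<dots> = c' \<oplus>\<^bsub>M\<^esub> \<ominus>\<^bsub>M\<^esub> c"
      using cl by (simp add: eq M.a_assoc M.r_neg1)
    finally have "\<ominus>\<^bsub>M\<^esub> a' \<oplus>\<^bsub>M\<^esub> a \<in> A \<inter> C"
      using that submodule_add[OF A submodule_minus[OF A]] submodule_add[OF C _ submodule_minus[OF C]]
      by (metis IntI)
    then have "\<ominus>\<^bsub>M\<^esub> a' \<oplus>\<^bsub>M\<^esub> a = \<zero>\<^bsub>M\<^esub>"
      using disj by blast
    then show ?thesis
      using cl by (metis M.a_inv_closed M.minus_equality M.minus_minus)
  qed
  \<comment> \<open>The \<open>A\<close>-component is taken by choice; \<open>unique\<close> makes
    the choice forced. Restricting the abstraction to \<open>carrier M\<close> provides the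
    extensionality that \<open>rmod_hom\<close> demands.\<close>
  define p where "p = (\<lambda>x \<in> carrier M. SOME a. a \<in> A \<and> (\<exists>c \<in> C. x = a \<oplus>\<^bsub>M\<^esub> c))"
  have p_mem: "p x \<in> A" and p_split: "\<exists>c \<in> C. x = p x \<oplus>\<^bsub>M\<^esub> c" if "x \<in> carrier M" for x
  proof -
    have "\<exists>a. a \<in> A \<and> (\<exists>c \<in> C. x = a \<oplus>\<^bsub>M\<^esub> c)"
      using that unfolding sum[symmetric] set_add_def' by blast
    from someI_ex[OF this] show "p x \<in> A" "\<exists>c \<in> C. x = p x \<oplus>\<^bsub>M\<^esub> c"
      using that by (simp_all add: p_def)
  qed
  \<comment> \<open>To evaluate \<open>p\<close> it is now enough to exhibit some decomposition of
    the argument. Linearity follows by adding decompositions, or by letting a scalar act on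
    one.\<close>
  have p_eq: "p (a \<oplus>\<^bsub>M\<^esub> c) = a" if "a \<in> A" "c \<in> C" for a c
    using p_mem[of "a \<oplus>\<^bsub>M\<^esub> c"] p_split[of "a \<oplus>\<^bsub>M\<^esub> c"] unique that
    by (metis M.a_closed Asub Csub)
  have p_id: "p x = x" if "x \<in> A" for x
    using p_eq[OF that submodule_zero[OF C]] Asub[OF that] by simp
  have "p \<in> rmod_hom R M M"
  proof (rule rmod_homI)
    fix x y assume x: "x \<in> carrier M" and y: "y \<in> carrier M"
    obtain c where c: "c \<in> C" "x = p x \<oplus>\<^bsub>M\<^esub> c" using p_split[OF x] by blast
    obtain d where d: "d \<in> C" "y = p y \<oplus>\<^bsub>M\<^esub> d" using p_split[OF y] by blast
    have "x \<oplus>\<^bsub>M\<^esub> y = (p x \<oplus>\<^bsub>M\<^esub> c) \<oplus>\<^bsub>M\<^esub> (p y \<oplus>\<^bsub>M\<^esub> d)"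
      using c d by simp
    also have "\<dots> = (p x \<oplus>\<^bsub>M\<^esub> p y) \<oplus>\<^bsub>M\<^esub> (c \<oplus>\<^bsub>M\<^esub> d)"
      using c(1) d(1) p_mem x y by (simp add: Asub Csub M.a_ac)
    finally show "p (x \<oplus>\<^bsub>M\<^esub> y) = p x \<oplus>\<^bsub>M\<^esub> p y"
      using p_eq submodule_add[OF A] submodule_add[OF C] p_mem x y c(1) d(1) by metis
  next
    fix a x assume a: "a \<in> carrier R" and x: "x \<in> carrier M"
    obtain c where c: "c \<in> C" "x = p x \<oplus>\<^bsub>M\<^esub> c" using p_split[OF x] by blast
    have "a \<odot>\<^bsub>M\<^esub> x = a \<odot>\<^bsub>M\<^esub> p x \<oplus>\<^bsub>M\<^esub> a \<odot>\<^bsub>M\<^esub> c"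
      using c p_mem[OF x] a by (metis Asub Csub rsmult_vector_distr)
    then show "p (a \<odot>\<^bsub>M\<^esub> x) = a \<odot>\<^bsub>M\<^esub> p x"
      using p_eq submodule_rsmult[OF A] submodule_rsmult[OF C] p_mem x a c(1) by metis
  qed (auto simp: p_mem Asub, simp add: p_def)
  moreover have "p ` carrier M = A"
    using p_mem p_id Asub by force
  ultimately show thesis
    using that p_id by blast
qed

text \<open>The identity is an idempotent endomorphism with image \<open>M\<close>. This is what
  allows \<open>A\<close> and \<open>B\<close> to be all of \<open>M\<close> in the converse
  direction.\<close>

lemma direct_summand_carrier: "direct_summand R M (carrier M)"
proof -
  have "(\<lambda>x \<in> carrier M. x) \<in> rmod_hom R M M"
    by (rule rmod_homI) auto
  from direct_summand_idempotent_image[OF this] show ?thesis by simp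
qed

end

lemma (in Rickart_module) direct_summand_a_kernel:
  assumes A: "direct_summand R M A" and B: "direct_summand R M B"
    and f: "f \<in> rmod_hom R (M\<lparr>carrier := A\<rparr>) (M\<lparr>carrier := B\<rparr>)"
  shows "direct_summand R (M\<lparr>carrier := A\<rparr>) (a_kernel (M\<lparr>carrier := A\<rparr>) (M\<lparr>carrier := B\<rparr>) f)"
proof -
  let ?A = "M\<lparr>carrier := A\<rparr>" and ?B = "M\<lparr>carrier := B\<rparr>"
  have subm: "submodule A R M" "submodule B R M"
    using A B unfolding direct_summand_def by auto
  note Asub = submodule_subset[OF subm(1), THEN subsetD]
    and Bsub = submodule_subset[OF subm(2), THEN subsetD]
  note fD = rmod_homD[OF f, simplified]
  interpret A: right_module R ?A by (rule right_module_submodule[OF subm(1)])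
  obtain p where p: "p \<in> rmod_hom R M M" and p_img: "p ` carrier M = A"
    and p_id: "\<And>x. x \<in> A \<Longrightarrow> p x = x"
    using direct_summand_projection[OF A] by blast
  note pD = rmod_homD[OF p]
  have p_mem: "p x \<in> A" if "x \<in> carrier M" for x using p_img that by blast
  \<comment> \<open>\<open>f\<close> may be applied after \<open>p\<close> because \<open>p\<close>
    lands in \<open>A\<close>; its values lie in \<open>B\<close>, hence in \<open>M\<close>, so the
    composite is an endomorphism of \<open>M\<close>.\<close>
  have "compose (carrier M) f p \<in> carrier (rmod_End R M)"
    unfolding rmod_End_def
    by (simp, rule rmod_homI) (auto simp: compose_eq fD pD p_mem Bsub)
  from kernel_eq_idempotent_image[OF this]
  obtain e where e: "e \<in> rmod_hom R M M" and ee: "compose (carrier M) e e = e"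
    and ker: "a_kernel M M (compose (carrier M) f p) = e ` carrier M"
    unfolding rmod_End_def by auto
  note eD = rmod_homD[OF e]
  have idem: "e (e x) = e x" if "x \<in> carrier M" for x
    using ee that by (metis compose_eq)
  have e_ker: "f (p (e x)) = \<zero>\<^bsub>M\<^esub>" if "x \<in> carrier M" for x
  proof -
    have "e x \<in> a_kernel M M (compose (carrier M) f p)" using ker that by blast
    then show ?thesis by (auto simp: a_kernel_eq compose_eq)
  qed
  \<comment> \<open>As \<open>p\<close> fixes \<open>x\<close>, f (p x) = f x = 0. So
    \<open>x\<close> lies in the kernel of the composite, which is the image of \<open>e\<close>,
    and an idempotent fixes its image pointwise.\<close>
  have e_id: "e x = x" if "x \<in> A" "f x = \<zero>\<^bsub>M\<^esub>" for x
  proof -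
    have "x \<in> a_kernel M M (compose (carrier M) f p)"
      using that Asub by (simp add: a_kernel_eq compose_eq p_id)
    then show ?thesis unfolding ker using idem by auto
  qed
  \<comment> \<open>The value \<open>e x\<close> may leave \<open>A\<close> even for
    \<open>x\<close> in \<open>A\<close>; applying \<open>p\<close> brings it back. Composing over
    \<open>A\<close> makes \<open>h\<close> extensional on \<open>A\<close>, as an endomorphism of
    \<open>A\<close> must be.\<close>
  define h where "h = compose A p e"
  have h_ext: "h \<in> extensional A" by (simp add: h_def)
  have h_eq: "h x = p (e x)" if "x \<in> A" for x using that by (simp add: h_def compose_eq)
  have h_mem: "h x \<in> A" if "x \<in> A" for x
    using that h_eq p_mem eD Asub by simp
  have h_ker: "f (h x) = \<zero>\<^bsub>M\<^esub>" if "x \<in> A" for x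
    using that h_eq e_ker Asub by simp
  have h_id: "h x = x" if "x \<in> A" "f x = \<zero>\<^bsub>M\<^esub>" for x
    using that h_eq e_id p_id by simp
  have "h \<in> rmod_hom R ?A ?A"
    by (rule rmod_homI)
      (auto simp: h_ext h_eq p_mem submodule_add[OF subm(1)] submodule_rsmult[OF subm(1)] eD pD Asub)
  \<comment> \<open>\<open>h\<close> maps \<open>A\<close> into the kernel of \<open>f\<close>
    (\<open>h_ker\<close>) and fixes that kernel pointwise (\<open>h_id\<close>); this yields both
    idempotence and the image.\<close>
  moreover have "h (h x) = h x" if "x \<in> A" for x
    using that h_mem h_ker h_id by simp
  moreover have "h ` A = a_kernel ?A ?B f"
    using h_mem h_ker h_id by (force simp: a_kernel_eq)
  \<comment> \<open>The criterion is applied inside the module \<open>A\<close>, so the complement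
    found is a submodule of \<open>A\<close>.\<close>
  ultimately show ?thesis
    using A.direct_summand_idempotent_image[of h] by simp
qed

theorem proposition2p2:
  fixes R :: "('a, 'k) ring_scheme" and M :: "('a, 'b, 'm) module_scheme"
  assumes "right_module R M"
  shows "Rickart_module R M \<longleftrightarrow>
    (\<forall>A B f. direct_summand R M A \<longrightarrow> direct_summand R M B \<longrightarrow>
      f \<in> rmod_hom R (M\<lparr>carrier := A\<rparr>) (M\<lparr>carrier := B\<rparr>) \<longrightarrow>
      direct_summand R (M\<lparr>carrier := A\<rparr>)
        (a_kernel (M\<lparr>carrier := A\<rparr>) (M\<lparr>carrier := B\<rparr>) f))" (is "_ \<longleftrightarrow> ?kernels")
proof
  assume "Rickart_module R M"
  then show ?kernels
    by (blast intro: Rickart_module.direct_summand_a_kernel)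
next
  assume kernels: ?kernels
  interpret right_module R M by fact
  show "Rickart_module R M"
  proof (intro Rickart_module.intro Rickart_module_axioms.intro)
    fix \<phi> assume "\<phi> \<in> carrier (rmod_End R M)"
    then have "\<phi> \<in> rmod_hom R M M"
      by (simp add: rmod_End_def)
    \<comment> \<open>For \<open>A\<close> and \<open>B\<close> equal to \<open>carrier M\<close>,
      the record update changes nothing, so the assumption speaks of \<open>M\<close> and \<phi>
      directly.\<close>
    then have "direct_summand R M (a_kernel M M \<phi>)"
      using kernels[rule_format, OF direct_summand_carrier direct_summand_carrier, of \<phi>] by simp
    then obtain p where p: "p \<in> rmod_hom R M M" "p ` carrier M = a_kernel M M \<phi>"
      "\<And>x. x \<in> a_kernel M M \<phi> \<Longrightarrow> p x = x"
      by (rule direct_summand_projection) blast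
    \<comment> \<open>On \<open>carrier M\<close>, \<open>p x\<close> lies in the kernel and is
      therefore fixed by \<open>p\<close>. Outside it both sides are \<open>undefined\<close>, so
      the equation holds for every \<open>x\<close> and gives equality of functions.\<close>
    have "compose (carrier M) p p x = p x" for x
      using p by (cases "x \<in> carrier M") (auto simp: compose_def rmod_hom_def)
    with p show "\<exists>e \<in> carrier (rmod_End R M).
        e \<otimes>\<^bsub>rmod_End R M\<^esub> e = e \<and> a_kernel M M \<phi> = e ` carrier M"
      by (auto simp: rmod_End_def fun_eq_iff)
  qed (fact assms)
qed

end
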